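(* Let $W_1\ne W_2$ be bandwidths in $(0,\tfrac12)$, with discrete band-limiting covariances $R_1,R_2$ and commuting Slepian tridiagonals $T_1,T_2$ on $\mathbb{C}^N$ ($[R_i,T_i]=0$), and put $R_0=\operatorname{diag}(R_1,R_2)$, $T_0=\operatorname{diag}(T_1,T_2)$ on $\mathbb{C}^2\otimes\mathbb{C}^N$. Assume $\operatorname{spec}(T_1)\cap\operatorname{spec}(T_2)=\varnothing$. Write a channel coupling as $\dot R=E_{12}\otimes S+E_{21}\otimes S^{\top}$ and $\dot T=E_{12}\otimes\tau+E_{21}\otimes\tau^{\top}$, with $S,\tau$ real $N\times N$ matrices and $\tau$ tridiagonal. Then the commutation condition $[\dot R,T_0]+[R_0,\dot T]=0$ is equivalent to the Sylvester relation $$T_1S-ST_2=R_1\tau-\tau R_2 .$$ Moreover the Sylvester map $S\mapsto T_1S-ST_2$ is invertible, so this relation determines $S$ uniquely from $\tau$ and the coupling tangent (the set of pairs $(S,\tau)$ satisfying it) is parametrized by the tridiagonal $\tau$.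
   Context: $[X,Y]=XY-YX$; $E_{ij}$ are the $2\times2$ matrix units. For bandwidth $W$, the band-limiting covariance is the $N\times N$ matrix with $R_{mn}=\frac{\sin(2\pi W(m-n))}{\pi(m-n)}$ for $m\ne n$, $R_{nn}=2W$, and Slepian's tridiagonal is the symmetric matrix with $T_{nn}=\bigl(\tfrac{N-1-2n}{2}\bigr)^2\cos(2\pi W)$, $T_{n,n+1}=T_{n+1,n}=\tfrac12(n+1)(N-1-n)$, indices $0,\dots,N-1$. *)

theory Defs
  imports "Jordan_Normal_Form.Spectral_Radius"
begin

definition commutator :: "'a :: ring mat \<Rightarrow> 'a mat \<Rightarrow> 'a mat" where
  "commutator X Y = X * Y - Y * X"

(* The first tensor factor is the outer (block) index, so that
   kronecker (mat_unit 1 2) S is the 2 x 2 block matrix with S in the upper right block. *)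
definition kronecker :: "'a :: semiring_0 mat \<Rightarrow> 'a mat \<Rightarrow> 'a mat" where
  "kronecker A B = mat (dim_row A * dim_row B) (dim_col A * dim_col B)
     (\<lambda>(i, j). A $$ (i div dim_row B, j div dim_col B) * B $$ (i mod dim_row B, j mod dim_col B))"

(* 2 x 2 matrix units; the labels i, j are 1-based, while matrix indices start at 0. *)
definition mat_unit :: "nat \<Rightarrow> nat \<Rightarrow> 'a :: zero_neq_one mat" where
  "mat_unit i j = mat 2 2 (\<lambda>(a, b). if Suc a = i \<and> Suc b = j then 1 else 0)"

definition block_diag :: "'a :: zero mat \<Rightarrow> 'a mat \<Rightarrow> 'a mat" where
  "block_diag A B = four_block_mat A (0\<^sub>m (dim_row A) (dim_col B)) (0\<^sub>m (dim_row B) (dim_col A)) B"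

definition band_cov :: "nat \<Rightarrow> real \<Rightarrow> complex mat" where
  "band_cov N W = mat N N (\<lambda>(m, n). complex_of_real
     (if m = n then 2 * W
      else sin (2 * pi * W * (real m - real n)) / (pi * (real m - real n))))"

definition slepian :: "nat \<Rightarrow> real \<Rightarrow> complex mat" where
  "slepian N W = mat N N (\<lambda>(m, n). complex_of_real
     (if m = n then ((real N - 1 - 2 * real n) / 2)\<^sup>2 * cos (2 * pi * W)
      else if n = Suc m then (real m + 1) * (real N - 1 - real m) / 2
      else if m = Suc n then (real n + 1) * (real N - 1 - real n) / 2
      else 0))"

definition real_mats :: "nat \<Rightarrow> complex mat set" where
  "real_mats N = {A \<in> carrier_mat N N. elements_mat A \<subseteq> \<real>}"

definition tridiagonal :: "'a :: zero mat \<Rightarrow> bool" where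
  "tridiagonal A \<longleftrightarrow>
     (\<forall>i < dim_row A. \<forall>j < dim_col A. Suc i < j \<or> Suc j < i \<longrightarrow> A $$ (i, j) = 0)"

definition channel_coupling :: "complex mat \<Rightarrow> complex mat" where
  "channel_coupling S = kronecker (mat_unit 1 2) S + kronecker (mat_unit 2 1) (transpose_mat S)"

definition sylvester :: "complex mat \<Rightarrow> complex mat \<Rightarrow> complex mat \<Rightarrow> complex mat" where
  "sylvester A B S = A * S - S * B"

definition coupling_tangent ::
  "nat \<Rightarrow> complex mat \<Rightarrow> complex mat \<Rightarrow> complex mat \<Rightarrow> complex mat \<Rightarrow> (complex mat \<times> complex mat) set"
  where
  "coupling_tangent N R1 R2 T1 T2 =
     {(S, \<tau>). S \<in> real_mats N \<and> \<tau> \<in> real_mats N \<and> tridiagonal \<tau> \<and>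
        sylvester T1 T2 S = R1 * \<tau> - \<tau> * R2}"

lemma sum_tridiagonal:
  fixes f t :: "nat \<Rightarrow> 'a :: comm_semiring_1"
  assumes n: "n < N" and t: "\<And>k. Suc k < n \<or> Suc n < k \<Longrightarrow> t k = 0"
  shows "(\<Sum>k<N. f k * t k) = f n * t n + (if n = 0 then 0 else f (n - 1) * t (n - 1))
           + (if Suc n < N then f (Suc n) * t (Suc n) else 0)"
proof -
  let ?A = "{k. k < N \<and> (k = n \<or> (n > 0 \<and> k = n - 1) \<or> k = Suc n)}"
  have "(\<Sum>k<N. f k * t k) = (\<Sum>k\<in>?A. f k * t k)"
  proof (rule sum.mono_neutral_right)
    show "\<forall>k\<in>{..<N} - ?A. f k * t k = 0"
    proof
      fix k assume "k \<in> {..<N} - ?A"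
      then have "Suc k < n \<or> Suc n < k" by auto
      then show "f k * t k = 0" using t by simp
    qed
  qed auto
  also have "?A = {n} \<union> (if n = 0 then {} else {n - 1}) \<union> (if Suc n < N then {Suc n} else {})"
    using n by auto
  also have "(\<Sum>k\<in>\<dots>. f k * t k) = f n * t n + (if n = 0 then 0 else f (n - 1) * t (n - 1))
           + (if Suc n < N then f (Suc n) * t (Suc n) else 0)"
    by (auto simp: algebra_simps)
  finally show ?thesis .
qed

lemma band_slepian_identity:
  fixes r :: "real \<Rightarrow> real" and a b M \<theta> :: real
  assumes r: "\<And>d. d * r d = sin (\<theta> * d) / pi"
  defines "t \<equiv> \<lambda>x. ((M - 1 - 2 * x) / 2)\<^sup>2 * cos \<theta>"
  shows "r (a - b) * t b + r (a - (b - 1)) * (b * (M - b) / 2)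
           + r (a - (b + 1)) * ((b + 1) * (M - 1 - b) / 2)
       = r (a - b) * t a + r (a - 1 - b) * (a * (M - a) / 2)
           + r (a + 1 - b) * ((a + 1) * (M - 1 - a) / 2)"
proof -
  define d where "d = a - b"
  define K where "K = M - 1 - a - b"
  have e: "a - (b - 1) = d + 1" "a - (b + 1) = d - 1" "a - 1 - b = d - 1" "a + 1 - b = d + 1"
    "a - b = d"
    by (simp_all add: d_def)
  have 1: "r (d + 1) * (b * (M - b) / 2) - r (d + 1) * ((a + 1) * (M - 1 - a) / 2)
      = - (K / 2) * ((d + 1) * r (d + 1))"
    by (simp add: d_def K_def field_simps)
  have 2: "r (d - 1) * ((b + 1) * (M - 1 - b) / 2) - r (d - 1) * (a * (M - a) / 2)
      = - (K / 2) * ((d - 1) * r (d - 1))"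
    by (simp add: d_def K_def field_simps)
  have 3: "r d * t b - r d * t a = K * cos \<theta> * (d * r d)"
    unfolding t_def d_def K_def by (simp add: field_simps power2_eq_square)
  have 4: "sin (\<theta> * (d + 1)) + sin (\<theta> * (d - 1)) = 2 * sin (\<theta> * d) * cos \<theta>"
    by (simp add: distrib_left right_diff_distrib sin_add sin_diff)
  have "K * cos \<theta> * (d * r d) - (K / 2) * ((d + 1) * r (d + 1)) - (K / 2) * ((d - 1) * r (d - 1))
     = K / (2 * pi) * (2 * sin (\<theta> * d) * cos \<theta> - (sin (\<theta> * (d + 1)) + sin (\<theta> * (d - 1))))"
    unfolding r by (simp add: field_simps)
  also have "\<dots> = 0" using 4 by simp
  finally show ?thesis using 1 2 3 unfolding e by linarith
qed

theorem band_cov_slepian_commute: "commutator (band_cov N W) (slepian N W) = 0\<^sub>m N N"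
proof -
  define r :: "real \<Rightarrow> real" where
    "r = (\<lambda>d. if d = 0 then 2 * W else sin (2 * pi * W * d) / (pi * d))"
  define t :: "nat \<Rightarrow> nat \<Rightarrow> real" where
    "t = (\<lambda>m n. (if m = n then ((real N - 1 - 2 * real n) / 2)\<^sup>2 * cos (2 * pi * W)
      else if n = Suc m then (real m + 1) * (real N - 1 - real m) / 2
      else if m = Suc n then (real n + 1) * (real N - 1 - real n) / 2
      else 0))"
  have R: "band_cov N W = mat N N (\<lambda>(m, n). complex_of_real (r (real m - real n)))"
    unfolding band_cov_def r_def by (rule cong_mat) auto
  have T: "slepian N W = mat N N (\<lambda>(m, n). complex_of_real (t m n))"
    unfolding slepian_def t_def by simp
  have rd: "d * r d = sin (2 * pi * W * d) / pi" for d
    unfolding r_def by auto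
  have sym: "t m n = t n m" for m n unfolding t_def by auto
  have main: "(\<Sum>k<N. r (real m - real k) * t k n) = (\<Sum>k<N. r (real k - real n) * t k m)"
    if m: "m < N" and n: "n < N" for m n
  proof -
    have L: "(\<Sum>k<N. r (real m - real k) * t k n)
      = r (real m - real n) * (((real N - 1 - 2 * real n) / 2)\<^sup>2 * cos (2 * pi * W))
        + r (real m - (real n - 1)) * (real n * (real N - real n) / 2)
        + r (real m - (real n + 1)) * ((real n + 1) * (real N - 1 - real n) / 2)"
    proof -
      have "real N - 1 - real n = 0" if "\<not> Suc n < N" using that n by linarith
      then show ?thesis
        by (subst sum_tridiagonal[OF n]) (auto simp: t_def of_nat_diff add.commute)
    qed
    have Q: "(\<Sum>k<N. r (real k - real n) * t k m)
      = r (real m - real n) * (((real N - 1 - 2 * real m) / 2)\<^sup>2 * cos (2 * pi * W))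
        + r (real m - 1 - real n) * (real m * (real N - real m) / 2)
        + r (real m + 1 - real n) * ((real m + 1) * (real N - 1 - real m) / 2)"
    proof -
      have "real N - 1 - real m = 0" if "\<not> Suc m < N" using that m by linarith
      then show ?thesis
        by (subst sum_tridiagonal[OF m]) (auto simp: t_def of_nat_diff add.commute)
    qed
    show ?thesis unfolding L Q by (rule band_slepian_identity) (rule rd)
  qed
  show ?thesis
  proof (rule eq_matI)
    fix m n assume "m < dim_row (0\<^sub>m N N :: complex mat)" "n < dim_col (0\<^sub>m N N :: complex mat)"
    then have mn: "m < N" "n < N" by auto
    have "commutator (band_cov N W) (slepian N W) $$ (m, n)
       = complex_of_real ((\<Sum>k<N. r (real m - real k) * t k n)
           - (\<Sum>k<N. r (real k - real n) * t k m))"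
      using mn unfolding commutator_def R T
      by (simp add: scalar_prod_def sym[of m] mult.commute atLeast0LessThan)
    then show "commutator (band_cov N W) (slepian N W) $$ (m, n) = 0\<^sub>m N N $$ (m, n)"
      using main[OF mn] mn by simp
  qed (auto simp: commutator_def band_cov_def slepian_def)
qed

end

theory Submission
  imports Defs
begin

text \<open>
  In block form the commutation condition has zero diagonal blocks, and its two off-diagonal blocks
  are negative transposes of each other because all the matrices $R_i$, $T_i$ are symmetric; so it
  amounts to the vanishing of the upper right block. The Sylvester map $S \mapsto T_1 S - S T_2$ is
  injective: after a Schur triangularization of $T_2$, the first nonzero column of a matrix in the
  kernel would be an eigenvector of $T_1$ for an eigenvalue of $T_2$. Vectorizing, it is given by a
  square matrix, hence bijective.
\<close>

section \<open>Block form of the commutation condition\<close>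

lemma kronecker_carrier [intro]:
  assumes "A \<in> carrier_mat n p" "B \<in> carrier_mat m q"
  shows "kronecker A B \<in> carrier_mat (n * m) (p * q)"
  using assms by (auto simp: kronecker_def)

lemma channel_coupling_four_block:
  assumes S: "S \<in> carrier_mat N N"
  shows "channel_coupling S = four_block_mat (0\<^sub>m N N) S (transpose_mat S) (0\<^sub>m N N)"
proof (rule eq_matI)
  let ?F = "four_block_mat (0\<^sub>m N N) S (transpose_mat S) (0\<^sub>m N N)"
  show "dim_row (channel_coupling S) = dim_row ?F" "dim_col (channel_coupling S) = dim_col ?F"
    using S by (auto simp: channel_coupling_def kronecker_def mat_unit_def)
  fix i j assume "i < dim_row ?F" "j < dim_col ?F"
  then have ij: "i < N + N" "j < N + N" using S by auto
  \<comment> \<open>As the first Kronecker factor is the outer index, \<open>k div N\<close> is the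
    block number and \<open>k mod N\<close> the position inside that block.\<close>
  have div: "k div N = (if k < N then 0 else 1)" "k mod N = (if k < N then k else k - N)"
    if "k < N + N" for k
    using that by (auto simp: not_less div_nat_eqI mod_if)
  show "channel_coupling S $$ (i, j) = ?F $$ (i, j)"
    using S ij div[OF ij(1)] div[OF ij(2)]
    by (auto simp: channel_coupling_def kronecker_def mat_unit_def)
qed

text \<open>The two sides are cut at the same row \<open>r1\<close> and the same column
  \<open>c1\<close>, so each block can be read off from entries at shifted indices. Without common
  block sizes, equality of the whole matrices would not give equality of the blocks.\<close>

lemma four_block_mat_eq_iff:
  assumes "A1 \<in> carrier_mat r1 c1" "B1 \<in> carrier_mat r1 c2" "C1 \<in> carrier_mat r2 c1" "D1 \<in> carrier_mat r2 c2"
    and "A2 \<in> carrier_mat r1 c1" "B2 \<in> carrier_mat r1 c2" "C2 \<in> carrier_mat r2 c1" "D2 \<in> carrier_mat r2 c2"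
  shows "four_block_mat A1 B1 C1 D1 = four_block_mat A2 B2 C2 D2 \<longleftrightarrow>
    A1 = A2 \<and> B1 = B2 \<and> C1 = C2 \<and> D1 = D2"
proof
  assume eq: "four_block_mat A1 B1 C1 D1 = four_block_mat A2 B2 C2 D2"
  have ix: "four_block_mat A1 B1 C1 D1 $$ (i, j) = four_block_mat A2 B2 C2 D2 $$ (i, j)" for i j
    using eq by simp
  show "A1 = A2 \<and> B1 = B2 \<and> C1 = C2 \<and> D1 = D2"
  proof (intro conjI eq_matI)
    fix i j assume "i < dim_row A2" "j < dim_col A2"
    then show "A1 $$ (i, j) = A2 $$ (i, j)" using ix[of i j] assms by simp
  next
    fix i j assume "i < dim_row B2" "j < dim_col B2"
    then show "B1 $$ (i, j) = B2 $$ (i, j)" using ix[of i "c1 + j"] assms by simp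
  next
    fix i j assume "i < dim_row C2" "j < dim_col C2"
    then show "C1 $$ (i, j) = C2 $$ (i, j)" using ix[of "r1 + i" j] assms by simp
  next
    fix i j assume "i < dim_row D2" "j < dim_col D2"
    then show "D1 $$ (i, j) = D2 $$ (i, j)" using ix[of "r1 + i" "c1 + j"] assms by simp
  qed (use assms in auto)
qed simp

lemma coupling_commutation_iff:
  fixes S \<tau> T1 T2 R1 R2 :: "complex mat"
  assumes S: "S \<in> carrier_mat N N" and t: "\<tau> \<in> carrier_mat N N"
    and c: "R1 \<in> carrier_mat N N" "R2 \<in> carrier_mat N N" "T1 \<in> carrier_mat N N" "T2 \<in> carrier_mat N N"
    and sym: "transpose_mat R1 = R1" "transpose_mat R2 = R2" "transpose_mat T1 = T1" "transpose_mat T2 = T2"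
  shows "commutator (channel_coupling S) (block_diag T1 T2)
      + commutator (block_diag R1 R2) (channel_coupling \<tau>) = 0\<^sub>m (2 * N) (2 * N)
    \<longleftrightarrow> T1 * S - S * T2 = R1 * \<tau> - \<tau> * R2"
proof -
  \<comment> \<open>\<open>X\<close> and \<open>Y\<close> are the upper right and lower left blocks
    of the left side of the condition. The commutator with \<open>block_diag T1 T2\<close>
    contributes \<open>S * T2 - T1 * S\<close> to \<open>X\<close>, which is the negative of the
    Sylvester map; this sign moves the \<open>\<tau>\<close> terms to the other side of the final
    relation.\<close>
  define X where "X = S * T2 - T1 * S + (R1 * \<tau> - \<tau> * R2)"
  define Y where "Y = transpose_mat S * T1 - T2 * transpose_mat S + (R2 * transpose_mat \<tau> - transpose_mat \<tau> * R1)"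
  have X: "X \<in> carrier_mat N N" and Y: "Y \<in> carrier_mat N N"
    unfolding X_def Y_def using S t c by auto
  have minus_block: "four_block_mat (0\<^sub>m N N) B C (0\<^sub>m N N) - four_block_mat (0\<^sub>m N N) B' C' (0\<^sub>m N N)
      = four_block_mat (0\<^sub>m N N) (B - B') (C - C') (0\<^sub>m N N)"
    if "B \<in> carrier_mat N N" "C \<in> carrier_mat N N" "B' \<in> carrier_mat N N" "C' \<in> carrier_mat N N"
    for B C B' C' :: "complex mat"
    by (rule eq_matI) (use that in auto)
  have L: "commutator (channel_coupling S) (block_diag T1 T2)
      + commutator (block_diag R1 R2) (channel_coupling \<tau>)
    = four_block_mat (0\<^sub>m N N) X Y (0\<^sub>m N N)"
    using S t c
    by (simp add: X_def Y_def mult_carrier_mat[of _ N N _ N] minus_carrier_mat commutator_def block_diag_def channel_coupling_four_block minus_block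
        mult_four_block_mat[of _ N N _ N _ N _ _ N _ N] add_four_block_mat[of _ N N _ N _ N])
  have Z: "0\<^sub>m (2 * N) (2 * N) = four_block_mat (0\<^sub>m N N) (0\<^sub>m N N) (0\<^sub>m N N) (0\<^sub>m N N :: complex mat)"
    by (simp add: mult_2)
  \<comment> \<open>Transposition reverses products and fixes \<open>R1\<close>, \<open>R2\<close>,
    \<open>T1\<close>, \<open>T2\<close>, so each of the four products in \<open>X\<close> turns
    into one in \<open>Y\<close> with the opposite sign.\<close>
  have YX: "Y = - transpose_mat X"
  proof (rule eq_matI)
    fix i j assume "i < dim_row (- transpose_mat X)" "j < dim_col (- transpose_mat X)"
    then have ij: "i < N" "j < N" using X by auto
    have tr: "transpose_mat (A * B) $$ (i, j) = (transpose_mat B * transpose_mat A) $$ (i, j)"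
      if "A \<in> carrier_mat N N" "B \<in> carrier_mat N N" for A B :: "complex mat"
      using transpose_mult[OF that] by simp
    have tr': "(A * B) $$ (j, i) = (transpose_mat B * transpose_mat A) $$ (i, j)"
      if "A \<in> carrier_mat N N" "B \<in> carrier_mat N N" for A B :: "complex mat"
      using tr[OF that] ij that by simp
    \<comment> \<open>Without \<open>index_mult_mat(1)\<close> the entries of products stay opaque
      instead of unfolding into scalar products, and the goal is linear in them.\<close>
    show "Y $$ (i, j) = (- transpose_mat X) $$ (i, j)"
      using S t c ij tr'[OF S c(4)] tr'[OF c(3) S] tr'[OF c(1) t] tr'[OF t c(2)] sym
      by (simp add: X_def Y_def del: index_mult_mat(1))
  qed (use X Y in auto)
  have X0: "X = 0\<^sub>m N N \<longleftrightarrow> T1 * S - S * T2 = R1 * \<tau> - \<tau> * R2"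
  proof -
    have "X = 0\<^sub>m N N \<longleftrightarrow> (\<forall>i<N. \<forall>j<N. (S * T2) $$ (i,j) - (T1 * S) $$ (i,j)
        + ((R1 * \<tau>) $$ (i,j) - (\<tau> * R2) $$ (i,j)) = 0)"
      unfolding mat_eq_iff using S t c by (simp add: X_def del: index_mult_mat(1))
    moreover have "T1 * S - S * T2 = R1 * \<tau> - \<tau> * R2 \<longleftrightarrow> (\<forall>i<N. \<forall>j<N. (T1 * S) $$ (i,j) - (S * T2) $$ (i,j)
        = (R1 * \<tau>) $$ (i,j) - (\<tau> * R2) $$ (i,j))"
      unfolding mat_eq_iff using S t c by (simp del: index_mult_mat(1))
    moreover have "a - b + (c - d) = 0 \<longleftrightarrow> b - a = c - d" for a b c d :: complex
      by (metis (no_types, lifting) add.commute diff_eq_diff_eq diff_self eq_iff_diff_eq_0 minus_diff_eq neg_eq_iff_add_eq_0)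
    ultimately show ?thesis by simp
  qed
  have "four_block_mat (0\<^sub>m N N) X Y (0\<^sub>m N N) = 0\<^sub>m (2 * N) (2 * N) \<longleftrightarrow> X = 0\<^sub>m N N \<and> Y = 0\<^sub>m N N"
    unfolding Z using X Y by (subst four_block_mat_eq_iff) auto
  also have "\<dots> \<longleftrightarrow> X = 0\<^sub>m N N" using YX by auto
  finally show ?thesis unfolding L X0 .
qed

section \<open>Triviality of the Sylvester kernel\<close>

lemma sylvester_kernel_trivial:
  fixes A B S :: "complex mat"
  assumes A: "A \<in> carrier_mat n n" and B: "B \<in> carrier_mat m m" and S: "S \<in> carrier_mat n m"
    and disj: "spectrum A \<inter> spectrum B = {}" and eq: "A * S = S * B"
  shows "S = 0\<^sub>m n m"
proof -
  obtain es where es: "char_poly B = (\<Prod>a\<leftarrow>es. [:- a, 1:])"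
    using char_poly_factorized[OF B] by blast
  obtain C P Q where "schur_decomposition B es = (C, P, Q)"
    by (cases "schur_decomposition B es")
  with schur_decomposition[OF B es] have wit: "similar_mat_wit B C P Q"
    and tri: "upper_triangular C" by auto
  note w = similar_mat_witD2[OF B wit]
  \<comment> \<open>With \<open>B = P * C * Q\<close> and \<open>Q\<close> inverse to
    \<open>P\<close>, multiplying \<open>A * S = S * B\<close> by \<open>P\<close> on the right
    gives \<open>A * X = X * C\<close>, where \<open>C\<close> is upper triangular.\<close>
  define X where "X = S * P"
  have X: "X \<in> carrier_mat n m" using S w by (auto simp: X_def)
  have "B * P = P * C"
  proof -
    have "B * P = P * C * (Q * P)"
      unfolding w(3) by (rule assoc_mult_mat[of _ m m _ m _ m]) (use w in auto)
    then show ?thesis using w(2,5,6) by simp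
  qed
  then have AX: "A * X = X * C"
    using assoc_mult_mat[OF A S w(6)] assoc_mult_mat[OF S B w(6)] assoc_mult_mat[OF S w(6,5)] eq
    by (simp add: X_def)
  \<comment> \<open>By triangularity, column \<open>j\<close> of \<open>X * C\<close> involves only
    the columns of \<open>X\<close> up to \<open>j\<close>. The earlier ones vanish by induction,
    which leaves \<open>A\<close> acting on column \<open>j\<close> as the scalar
    \<open>C $$ (j, j)\<close>.\<close>
  have "col X j = 0\<^sub>v n" if "j < m" for j
    using that
  proof (induction j rule: less_induct)
    case (less j)
    have "A *\<^sub>v col X j = C $$ (j, j) \<cdot>\<^sub>v col X j"
    proof (rule eq_vecI)
      fix i assume "i < dim_vec (C $$ (j, j) \<cdot>\<^sub>v col X j)"
      then have i: "i < n" using X by auto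
      have zero: "X $$ (i, k) * C $$ (k, j) = 0" if k: "k < m" "k \<noteq> j" for k
      proof (cases "k < j")
        case True
        then have "col X k $ i = 0" using less.IH[of k] k i by simp
        then show ?thesis using X i k by simp
      next
        case False
        then have "C $$ (k, j) = 0" using tri k w(5) by (intro upper_triangularD) auto
        then show ?thesis by simp
      qed
      have "(A *\<^sub>v col X j) $ i = (A * X) $$ (i, j)"
        using A X i less.prems by simp
      also have "\<dots> = (\<Sum>k<m. X $$ (i, k) * C $$ (k, j))"
        unfolding AX using X w(5) i less.prems by (simp add: scalar_prod_def atLeast0LessThan)
      also have "\<dots> = X $$ (i, j) * C $$ (j, j)"
        using less.prems by (subst sum.remove[of _ j]) (auto intro!: sum.neutral zero)
      finally show "(A *\<^sub>v col X j) $ i = (C $$ (j, j) \<cdot>\<^sub>v col X j) $ i"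
        using X i less.prems by simp
    qed (use A X in auto)
    \<comment> \<open>Similar matrices share their characteristic polynomial, so the diagonal
      entries of \<open>C\<close> are eigenvalues of \<open>B\<close>, and disjointness of the
      spectra applies.\<close>
    moreover have "C $$ (j, j) \<notin> spectrum A"
    proof -
      have "char_poly B = (\<Prod>a\<leftarrow>diag_mat C. [:- a, 1:])"
        using char_poly_similar[of B C] char_poly_upper_triangular[OF w(5) tri] wit
        by (auto simp: similar_mat_def)
      moreover have "C $$ (j, j) \<in> set (diag_mat C)"
        using less.prems w(5) by (auto simp: diag_mat_def)
      ultimately have "eigenvalue B (C $$ (j, j))"
        unfolding eigenvalue_root_char_poly[OF B]
        by (force simp: poly_prod_list prod_list_zero_iff)
      then show ?thesis using disj by (auto simp: spectrum_def)
    qed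
    moreover have "col X j \<in> carrier_vec n" using X by auto
    ultimately show ?case
      using A by (auto simp: spectrum_def eigenvalue_def eigenvector_def)
  qed
  then have "X = 0\<^sub>m n m"
    using X by (intro mat_col_eqI) auto
  then have "S * (P * Q) = 0\<^sub>m n m * Q"
    using assoc_mult_mat[OF S w(6,7)] by (simp add: X_def)
  then show ?thesis using S w(1,7) by simp
qed

section \<open>Row-major vectorization\<close>

text \<open>Rows are laid out one after another, so that \<open>div\<close> yields the row and
  \<open>mod\<close> the column. This matches the outer and inner indices of
  \<open>kronecker\<close>.\<close>

definition vectorize :: "'a mat \<Rightarrow> 'a vec" where
  "vectorize S = vec (dim_row S * dim_col S) (\<lambda>k. S $$ (k div dim_col S, k mod dim_col S))"

lemma vectorize_carrier [simp]:
  "S \<in> carrier_mat n m \<Longrightarrow> vectorize S \<in> carrier_vec (n * m)"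
  by (auto simp: vectorize_def)

lemma div_mod_less:
  fixes k n m :: nat
  assumes "k < n * m"
  shows "k div m < n" "k mod m < m"
  using assms by (auto simp: less_mult_imp_div_less intro!: mod_less_divisor Nat.gr0I)

lemma vectorize_minus:
  assumes "S \<in> carrier_mat n m" "T \<in> carrier_mat n m"
  shows "vectorize (S - T) = vectorize S - vectorize T"
proof (rule eq_vecI)
  fix k assume "k < dim_vec (vectorize S - vectorize T)"
  then have k: "k < n * m" using assms by (auto simp: vectorize_def)
  from div_mod_less[OF this] show "vectorize (S - T) $ k = (vectorize S - vectorize T) $ k"
    using k assms by (simp add: vectorize_def)
qed (use assms in \<open>auto simp: vectorize_def\<close>)

lemma bij_betw_vectorize: "bij_betw vectorize (carrier_mat n m :: 'a mat set) (carrier_vec (n * m))"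
proof (rule bij_betw_byWitness[where f' = "\<lambda>v. mat n m (\<lambda>(i, j). v $ (i * m + j))"])
  have lt: "i * m + j < n * m" if "i < n" "j < m" for i j
  proof -
    have "i * m + j < Suc i * m" using that by simp
    also have "\<dots> \<le> n * m" using that by (intro mult_le_mono1) simp
    finally show ?thesis .
  qed
  show "\<forall>S\<in>carrier_mat n m :: 'a mat set. mat n m (\<lambda>(i, j). vectorize S $ (i * m + j)) = S"
    using lt by (auto simp: vectorize_def intro!: eq_matI)
  show "\<forall>v\<in>carrier_vec (n * m) :: 'a vec set. vectorize (mat n m (\<lambda>(i, j). v $ (i * m + j))) = v"
  proof
    fix v :: "'a vec" assume v: "v \<in> carrier_vec (n * m)"
    show "vectorize (mat n m (\<lambda>(i, j). v $ (i * m + j))) = v"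
      using v by (auto simp: vectorize_def div_mod_less intro!: eq_vecI)
  qed
qed auto

text \<open>The range below \<open>n * m\<close> splits into \<open>n\<close> consecutive runs of
  length \<open>m\<close>; on each run the quotient is constant and the remainder runs through all
  values below \<open>m\<close>.\<close>

lemma sum_div_mod:
  fixes f :: "nat \<Rightarrow> nat \<Rightarrow> 'a :: comm_monoid_add"
  shows "(\<Sum>k<n * m. f (k div m) (k mod m)) = (\<Sum>i<n. \<Sum>j<m. f i j)"
proof -
  have "(\<Sum>k<n * m. f (k div m) (k mod m)) = (\<Sum>i<n. \<Sum>k = i * m..<i * m + m. f (k div m) (k mod m))"
    by (rule sum.nat_group[symmetric])
  also have "\<dots> = (\<Sum>i<n. \<Sum>j<m. f i j)"
  proof (rule sum.cong[OF refl])
    fix i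
    have "(\<Sum>k = i * m..<i * m + m. f (k div m) (k mod m))
        = (\<Sum>j = 0..<m. f ((j + i * m) div m) ((j + i * m) mod m))"
      using sum.shift_bounds_nat_ivl[of "\<lambda>k. f (k div m) (k mod m)" 0 "i * m" m] by (simp add: add.commute)
    also have "\<dots> = (\<Sum>j<m. f i j)"
      unfolding atLeast0LessThan by (rule sum.cong) auto
    finally show "(\<Sum>k = i * m..<i * m + m. f (k div m) (k mod m)) = (\<Sum>j<m. f i j)" .
  qed
  finally show ?thesis .
qed

text \<open>The standard vec identity in its row-major form, which represents two-sided
  multiplication by a matrix. The transpose appears because \<open>B\<close> is summed over its row
  index in \<open>A * S * B\<close>, whereas a matrix acting on a vector is summed over its column
  index.\<close>

lemma kronecker_mult_vectorize:
  fixes A B S :: "'a :: comm_ring_1 mat"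
  assumes A: "A \<in> carrier_mat n p" and S: "S \<in> carrier_mat p q" and B: "B \<in> carrier_mat q m"
  shows "kronecker A (transpose_mat B) *\<^sub>v vectorize S = vectorize (A * S * B)"
proof (rule eq_vecI)
  fix k assume "k < dim_vec (vectorize (A * S * B))"
  then have k: "k < n * m" using A B by (auto simp: vectorize_def)
  note ij = div_mod_less[OF this]
  have "(kronecker A (transpose_mat B) *\<^sub>v vectorize S) $ k
      = (\<Sum>l<p * q. A $$ (k div m, l div q) * B $$ (l mod q, k mod m) * S $$ (l div q, l mod q))"
    using A B S k ij
    by (auto simp: div_mod_less scalar_prod_def kronecker_def vectorize_def atLeast0LessThan intro!: sum.cong)
  also have "\<dots> = (\<Sum>i<p. \<Sum>j<q. A $$ (k div m, i) * B $$ (j, k mod m) * S $$ (i, j))"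
    by (rule sum_div_mod)
  also have "\<dots> = (A * S * B) $$ (k div m, k mod m)"
    using A B S ij
    by (auto simp: scalar_prod_def atLeast0LessThan sum_distrib_left mult_ac intro!: sum.cong)
  finally show "(kronecker A (transpose_mat B) *\<^sub>v vectorize S) $ k = vectorize (A * S * B) $ k"
    using k A B by (simp add: vectorize_def)
qed (use A B in \<open>auto simp: vectorize_def kronecker_def\<close>)

section \<open>Bijectivity of the Sylvester map\<close>

lemma sylvester_carrier [intro]:
  "A \<in> carrier_mat n n \<Longrightarrow> B \<in> carrier_mat m m \<Longrightarrow> S \<in> carrier_mat n m \<Longrightarrow> sylvester A B S \<in> carrier_mat n m"
  by (auto simp: sylvester_def)

theorem bij_betw_sylvester:
  fixes A B :: "complex mat"
  assumes A: "A \<in> carrier_mat n n" and B: "B \<in> carrier_mat m m"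
    and disj: "spectrum A \<inter> spectrum B = {}"
  shows "bij_betw (sylvester A B) (carrier_mat n m) (carrier_mat n m)"
proof -
  \<comment> \<open>This is the matrix of the Sylvester map in row-major coordinates, obtained by
    writing \<open>A * S\<close> as \<open>A * S * 1\<close> and \<open>S * B\<close> as
    \<open>1 * S * B\<close>.\<close>
  define M where "M = kronecker A (transpose_mat (1\<^sub>m m)) - kronecker (1\<^sub>m n) (transpose_mat B)"
  have K: "kronecker A (transpose_mat (1\<^sub>m m)) \<in> carrier_mat (n * m) (n * m)"
    "kronecker (1\<^sub>m n) (transpose_mat B) \<in> carrier_mat (n * m) (n * m)"
    using A B by auto
  then have M: "M \<in> carrier_mat (n * m) (n * m)" by (auto simp: M_def)
  have MS: "M *\<^sub>v vectorize S = vectorize (sylvester A B S)" if S: "S \<in> carrier_mat n m" for S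
  proof -
    have "M *\<^sub>v vectorize S = vectorize (A * S * 1\<^sub>m m) - vectorize (1\<^sub>m n * S * B)"
      using kronecker_mult_vectorize[OF A S one_carrier_mat] kronecker_mult_vectorize[OF one_carrier_mat S B]
        minus_mult_distrib_mat_vec[OF K vectorize_carrier[OF S]]
      by (simp add: M_def)
    also have "\<dots> = vectorize (sylvester A B S)"
      using A B S by (simp add: sylvester_def vectorize_minus[of _ n m])
    finally show ?thesis .
  qed
  note V = bij_betw_vectorize[where ?'a = complex, of n m]
  \<comment> \<open>A singular \<open>M\<close> would kill a nonzero vector, and reshaping that
    vector into a matrix would contradict the triviality of the kernel.\<close>
  have "det M \<noteq> 0"
  proof
    assume "det M = 0"
    then obtain v where v: "v \<in> carrier_vec (n * m)" "v \<noteq> 0\<^sub>v (n * m)" "M *\<^sub>v v = 0\<^sub>v (n * m)"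
      unfolding det_0_iff_vec_prod_zero[OF M] by blast
    then obtain S where S: "S \<in> carrier_mat n m" "v = vectorize S"
      using V by (auto simp: bij_betw_def)
    have vec0: "vectorize (0\<^sub>m n m :: complex mat) = 0\<^sub>v (n * m)"
      by (auto simp: vectorize_def div_mod_less intro!: eq_vecI)
    have "sylvester A B S = 0\<^sub>m n m"
      using v(3) MS[OF S(1)] V A B S vec0
      by (auto simp: bij_betw_def inj_on_def sylvester_carrier)
    then have "A * S = S * B"
      using A B S unfolding sylvester_def mat_eq_iff by (simp del: index_mult_mat(1))
    then have "S = 0\<^sub>m n m" using sylvester_kernel_trivial[OF A B S(1) disj] by simp
    then show False using v S vec0 by simp
  qed
  then obtain M' where M': "M' \<in> carrier_mat (n * m) (n * m)" "M * M' = 1\<^sub>m (n * m)" "M' * M = 1\<^sub>m (n * m)"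
    using det_non_zero_imp_unit[OF M] by (auto simp: Units_def ring_mat_def)
  have "bij_betw ((*\<^sub>v) M) (carrier_vec (n * m)) (carrier_vec (n * m))"
  proof (rule bij_betw_byWitness[where f' = "(*\<^sub>v) M'"])
    show "\<forall>v\<in>carrier_vec (n * m). M' *\<^sub>v (M *\<^sub>v v) = v"
      using M M' by (metis assoc_mult_mat_vec one_mult_mat_vec)
    show "\<forall>v\<in>carrier_vec (n * m). M *\<^sub>v (M' *\<^sub>v v) = v"
      using M M' by (metis assoc_mult_mat_vec one_mult_mat_vec)
  qed (use M M' in auto)
  \<comment> \<open>On \<open>carrier_mat n m\<close>, applying \<open>M\<close> after
    \<open>vectorize\<close> agrees with \<open>vectorize\<close> after the Sylvester map; the outer
    bijection \<open>vectorize\<close> can then be cancelled.\<close>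
  from bij_betw_trans[OF V this]
  have "bij_betw (vectorize \<circ> sylvester A B) (carrier_mat n m) (carrier_vec (n * m))"
    by (rule bij_betw_cong[THEN iffD1, rotated]) (simp add: MS)
  then show ?thesis
    by (rule bij_betw_comp_iff2[OF V, THEN iffD2, rotated]) (use A B in auto)
qed

section \<open>Restriction to real matrices\<close>

text \<open>Reality becomes a fixed-point condition. Entrywise conjugation respects products and
  differences, so in this form it passes through the Sylvester map.\<close>

lemma real_mats_iff: "S \<in> real_mats N \<longleftrightarrow> S \<in> carrier_mat N N \<and> map_mat cnj S = S"
proof -
  have "elements_mat S \<subseteq> \<real> \<longleftrightarrow> (\<forall>i<dim_row S. \<forall>j<dim_col S. S $$ (i, j) \<in> \<real>)"
    by (force simp: elements_mat_def)
  then show ?thesis by (auto simp: real_mats_def mat_eq_iff Reals_cnj_iff)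
qed

lemma map_mat_cnj_mult:
  assumes "A \<in> carrier_mat n p" "B \<in> carrier_mat p m"
  shows "map_mat cnj (A * B) = map_mat cnj A * map_mat cnj B"
  using assms by (auto simp: scalar_prod_def mat_eq_iff)

lemma map_mat_cnj_minus:
  assumes "A \<in> carrier_mat n m" "B \<in> carrier_mat n m"
  shows "map_mat cnj (A - B) = map_mat cnj A - map_mat cnj B"
  using assms by (auto simp: mat_eq_iff)

lemma real_mats_mult: "A \<in> real_mats N \<Longrightarrow> B \<in> real_mats N \<Longrightarrow> A * B \<in> real_mats N"
  by (auto simp: real_mats_iff map_mat_cnj_mult)

lemma real_mats_minus: "A \<in> real_mats N \<Longrightarrow> B \<in> real_mats N \<Longrightarrow> A - B \<in> real_mats N"
  by (auto simp: real_mats_iff map_mat_cnj_minus)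

text \<open>Complex conjugation maps solutions to solutions, so the unique solution for real data is real.\<close>

lemma bij_betw_sylvester_real:
  assumes A: "A \<in> real_mats N" and B: "B \<in> real_mats N"
    and disj: "spectrum A \<inter> spectrum B = {}"
  shows "bij_betw (sylvester A B) (real_mats N) (real_mats N)"
proof -
  have c: "A \<in> carrier_mat N N" "B \<in> carrier_mat N N" using A B by (auto simp: real_mats_iff)
  note bij = bij_betw_sylvester[OF c disj]
  have sub: "real_mats N \<subseteq> carrier_mat N N" by (auto simp: real_mats_def)
  have cnj: "map_mat cnj (sylvester A B S) = sylvester A B (map_mat cnj S)"
    if "S \<in> carrier_mat N N" for S
    using that A B by (simp add: sylvester_def real_mats_iff mult_carrier_mat[of _ N N _ N]
        map_mat_cnj_minus[of _ N N] map_mat_cnj_mult[of _ N N _ N])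
  have real: "S \<in> real_mats N" if S: "S \<in> carrier_mat N N" and "sylvester A B S \<in> real_mats N" for S
  proof -
    have "sylvester A B (map_mat cnj S) = sylvester A B S"
      using cnj[OF S] that(2) by (simp add: real_mats_iff)
    then have "map_mat cnj S = S"
      by (rule inj_onD[OF bij_betw_imp_inj_on[OF bij]]) (use S in auto)
    then show ?thesis using S by (simp add: real_mats_iff)
  qed
  have "sylvester A B S \<in> real_mats N" if "S \<in> real_mats N" for S
    using that A B by (simp add: sylvester_def real_mats_minus real_mats_mult)
  then have "sylvester A B ` real_mats N \<subseteq> real_mats N" by blast
  moreover have "C \<in> sylvester A B ` real_mats N" if C: "C \<in> real_mats N" for C
  proof -
    have "C \<in> sylvester A B ` carrier_mat N N"
      using C sub by (simp add: bij_betw_imp_surj_on[OF bij] subset_iff)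
    then show ?thesis using real C by blast
  qed
  ultimately have "sylvester A B ` real_mats N = real_mats N" by blast
  then show ?thesis
    using inj_on_subset[OF bij_betw_imp_inj_on[OF bij] sub] by (simp add: bij_betw_def)
qed

section \<open>Reality and symmetry of the Slepian data\<close>

lemma
  shows band_cov_real: "band_cov N W \<in> real_mats N"
    and slepian_real: "slepian N W \<in> real_mats N"
  by (auto simp: real_mats_iff band_cov_def slepian_def mat_eq_iff)

lemma transpose_band_cov: "transpose_mat (band_cov N W) = band_cov N W"
proof -
  \<comment> \<open>Numerator and denominator are both odd in \<open>a - b\<close>. For
    \<open>a = b\<close> both quotients are \<open>0\<close> by the convention for division by
    zero.\<close>
  have "sin (x * (a - b)) / (pi * (a - b)) = sin (x * (b - a)) / (pi * (b - a))" for x a b :: real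
    by (metis (no_types, opaque_lifting) minus_diff_eq minus_divide_divide mult_minus_right sin_minus)
  then show ?thesis by (auto simp: band_cov_def mat_eq_iff simp del: of_real_divide)
qed

lemma transpose_slepian: "transpose_mat (slepian N W) = slepian N W"
  by (auto simp: slepian_def mat_eq_iff)

text \<open>Invertibility is recorded both on all complex matrices and on the real ones, since a
  coupling has real blocks. The parametrization of the tangent is the graph map
  \<open>\<tau> \<mapsto> (S, \<tau>)\<close>, with \<open>S\<close> obtained from the inverse of
  the real Sylvester map.\<close>

theorem lemma12p4:
  fixes N :: nat and W1 W2 :: real
    and R1 R2 T1 T2 R0 T0 :: "complex mat"
  assumes "0 < W1" "W1 < 1 / 2" "0 < W2" "W2 < 1 / 2" "W1 \<noteq> W2"
    and "R1 = band_cov N W1" "R2 = band_cov N W2"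
    and "T1 = slepian N W1" "T2 = slepian N W2"
    and "R0 = block_diag R1 R2" "T0 = block_diag T1 T2"
    and "spectrum T1 \<inter> spectrum T2 = {}"
  shows
    "(\<forall>S \<in> real_mats N. \<forall>\<tau> \<in> real_mats N. tridiagonal \<tau> \<longrightarrow>
        (commutator (channel_coupling S) T0 + commutator R0 (channel_coupling \<tau>)
           = 0\<^sub>m (2 * N) (2 * N)
         \<longleftrightarrow> T1 * S - S * T2 = R1 * \<tau> - \<tau> * R2))
     \<and> bij_betw (sylvester T1 T2) (carrier_mat N N) (carrier_mat N N)
     \<and> bij_betw (sylvester T1 T2) (real_mats N) (real_mats N)
     \<and> (\<forall>\<tau> \<in> real_mats N. tridiagonal \<tau> \<longrightarrow>
          (\<exists>!S. S \<in> real_mats N \<and> T1 * S - S * T2 = R1 * \<tau> - \<tau> * R2))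
     \<and> bij_betw
          (\<lambda>\<tau>. (inv_into (real_mats N) (sylvester T1 T2) (R1 * \<tau> - \<tau> * R2), \<tau>))
          {\<tau> \<in> real_mats N. tridiagonal \<tau>}
          (coupling_tangent N R1 R2 T1 T2)"
proof -
  have r: "R1 \<in> real_mats N" "R2 \<in> real_mats N" "T1 \<in> real_mats N" "T2 \<in> real_mats N"
    using assms band_cov_real slepian_real by auto
  then have c: "R1 \<in> carrier_mat N N" "R2 \<in> carrier_mat N N" "T1 \<in> carrier_mat N N" "T2 \<in> carrier_mat N N"
    by (auto simp: real_mats_def)
  have sym: "transpose_mat R1 = R1" "transpose_mat R2 = R2" "transpose_mat T1 = T1" "transpose_mat T2 = T2"
    using assms transpose_band_cov transpose_slepian by auto
  have iff: "commutator (channel_coupling S) T0 + commutator R0 (channel_coupling \<tau>) = 0\<^sub>m (2 * N) (2 * N)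
         \<longleftrightarrow> T1 * S - S * T2 = R1 * \<tau> - \<tau> * R2" if "S \<in> real_mats N" "\<tau> \<in> real_mats N" for S \<tau>
    using coupling_commutation_iff[OF _ _ c sym] that assms(10,11) by (simp add: real_mats_def)
  note bij = bij_betw_sylvester_real[OF r(3,4) assms(12)]
  \<comment> \<open>This places the right side in the domain of the inverse on real matrices, so a
    real \<open>\<tau>\<close> yields a real \<open>S\<close>.\<close>
  have rhs: "R1 * \<tau> - \<tau> * R2 \<in> real_mats N" if "\<tau> \<in> real_mats N" for \<tau>
    using that r by (simp add: real_mats_mult real_mats_minus)
  have inv: "inv_into (real_mats N) (sylvester T1 T2) C \<in> real_mats N"
    "sylvester T1 T2 (inv_into (real_mats N) (sylvester T1 T2) C) = C" if "C \<in> real_mats N" for C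
    using bij_betw_apply[OF bij_betw_inv_into[OF bij] that] bij_betw_inv_into_right[OF bij that] by simp_all
  have ex1: "\<exists>!S. S \<in> real_mats N \<and> T1 * S - S * T2 = R1 * \<tau> - \<tau> * R2" if "\<tau> \<in> real_mats N" for \<tau>
  proof (rule ex_ex1I)
    show "\<exists>S. S \<in> real_mats N \<and> T1 * S - S * T2 = R1 * \<tau> - \<tau> * R2"
      using inv[OF rhs[OF that]] by (auto simp: sylvester_def)
    show "S = S'" if "S \<in> real_mats N \<and> T1 * S - S * T2 = R1 * \<tau> - \<tau> * R2"
      "S' \<in> real_mats N \<and> T1 * S' - S' * T2 = R1 * \<tau> - \<tau> * R2" for S S'
      by (rule inj_onD[OF bij_betw_imp_inj_on[OF bij]]) (use that in \<open>simp_all add: sylvester_def\<close>)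
  qed
  have "bij_betw (\<lambda>\<tau>. (inv_into (real_mats N) (sylvester T1 T2) (R1 * \<tau> - \<tau> * R2), \<tau>))
      {\<tau> \<in> real_mats N. tridiagonal \<tau>} (coupling_tangent N R1 R2 T1 T2)"
  \<comment> \<open>Projecting to \<open>\<tau>\<close> loses nothing: injectivity on real matrices
    recovers \<open>S\<close> from the relation.\<close>
  proof (rule bij_betw_byWitness[where f' = snd])
    show "\<forall>p\<in>coupling_tangent N R1 R2 T1 T2.
        (inv_into (real_mats N) (sylvester T1 T2) (R1 * snd p - snd p * R2), snd p) = p"
    proof
      fix p assume "p \<in> coupling_tangent N R1 R2 T1 T2"
      then have "fst p \<in> real_mats N" "R1 * snd p - snd p * R2 = sylvester T1 T2 (fst p)"
        by (auto simp: coupling_tangent_def)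
      then show "(inv_into (real_mats N) (sylvester T1 T2) (R1 * snd p - snd p * R2), snd p) = p"
        by (simp add: bij_betw_inv_into_left[OF bij])
    qed
  qed (auto simp: coupling_tangent_def inv rhs)
  then show ?thesis
    by (intro conjI ballI impI iff ex1 bij bij_betw_sylvester[OF c(3,4) assms(12)])
qed

end
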